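(* Let $N\ge 3$ be an integer, $\alpha=\pi/N$, and $x_0\in\mathbb{R}$ with $x_0\neq\pm1$. Let $\mathcal{P}$ be the family of harmonic $N$-gons obtained by inverting the regular $N$-gons inscribed in the unit circle centered at the origin with respect to the unit circle centered at $(x_0,0)$, and let $K$ be the symmedian point of $\mathcal{P}$. Then the polar image of $\mathcal{P}$ with respect to the unit circle centered at $K$ is a (Poncelet) family $\mathcal{H}$ of $N$-gons interscribed between two homothetic, concentric ellipses $\mathcal{E}_H$ (external; the polygons are inscribed in it) and $\mathcal{E}_h$ (internal; the sides of the polygons are tangent to it), given by $$\mathcal{E}_{H}:\ \frac{(x-x_H)^2}{a_H^2}+\frac{y^2}{b_H^2}-1=0,\qquad \mathcal{E}_h:\ \frac{(x-x_h)^2}{a_h^2}+\frac{y^2}{b_h^2}-1=0,$$ where $$a_h=\frac{(x_0^2+1)^2}{|1-x_0^2|},\quad b_h=x_0^2+1,\quad x_h=\frac{x_0(3x_0^4+3x_0^2+2)}{x_0^4-1},$$ $$a_H=\frac{a_h}{\cos\alpha},\quad b_H=\frac{b_h}{\cos\alpha},\quad x_H=x_h.$$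
   Context: For $t\in\mathbb{R}$ consider the regular $N$-gon with consecutive vertices $(\cos(2\alpha i+t),\sin(2\alpha i+t))$, $i=1,\dots,N$. The harmonic polygon $P_t\in\mathcal{P}$ has as consecutive vertices the inversions of these points with respect to the unit circle centered at $(x_0,0)$; $\mathcal{P}=\{P_t\}_{t\in\mathbb{R}}$. A polygon is harmonic if it is inscribed in a circle and there is an interior point $K$, its symmedian point, whose distance to each sideline is a fixed proportion of the corresponding sidelength. All members of $\mathcal{P}$ share the same symmedian point, explicitly $K=\left(\frac{x_0^3}{x_0^2+1},0\right)$. The polar image of a polygon with respect to a circle is the polygon whose vertices are the poles of the sidelines of the original polygon (consecutive sides giving consecutive vertices), so that its sidelines are the polars of the original vertices. *)

theory Defs
  imports "HOL-Analysis.Analysis"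
begin

type_synonym point = "real \<times> real"

(* A polygon with N vertices is an N-periodic sequence of points; its vertices are P 1, ..., P N. *)
type_synonym polygon = "nat \<Rightarrow> point"

definition ngon :: "nat \<Rightarrow> polygon \<Rightarrow> bool" where
  "ngon N P \<longleftrightarrow> (\<forall>i. P (i + N) = P i) \<and> inj_on P {1..N}"

definition side :: "polygon \<Rightarrow> nat \<Rightarrow> point set" where
  "side P i = closed_segment (P i) (P (Suc i))"

definition sideline :: "polygon \<Rightarrow> nat \<Rightarrow> point set" where
  "sideline P i = affine hull {P i, P (Suc i)}"

definition regular_ngon :: "nat \<Rightarrow> real \<Rightarrow> polygon" where
  "regular_ngon N t i = (cos (2 * (pi / real N) * real i + t), sin (2 * (pi / real N) * real i + t))"

definition inversion :: "point \<Rightarrow> real \<Rightarrow> point \<Rightarrow> point" where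
  "inversion c r p = c + (r\<^sup>2 / (norm (p - c))\<^sup>2) *\<^sub>R (p - c)"

definition harmonic_ngon :: "nat \<Rightarrow> real \<Rightarrow> real \<Rightarrow> polygon" where
  "harmonic_ngon N x0 t = (\<lambda>i. inversion (x0, 0) 1 (regular_ngon N t i))"

definition harmonic_family :: "nat \<Rightarrow> real \<Rightarrow> polygon set" where
  "harmonic_family N x0 = range (harmonic_ngon N x0)"

(* P is a harmonic N-gon with symmedian point K. The interior of the polygon is taken to be the
   interior of the convex hull of its vertices, which is the region it bounds when it is convex,
   i.e. when its vertices are listed in cyclic order on the circumcircle. *)
definition harmonic_with_symmedian_point :: "nat \<Rightarrow> polygon \<Rightarrow> point \<Rightarrow> bool" where
  "harmonic_with_symmedian_point N P K \<longleftrightarrow>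
     ngon N P \<and>
     (\<exists>c r. \<forall>i. dist c (P i) = r) \<and>
     K \<in> interior (convex hull (P ` {1..N})) \<and>
     (\<exists>k. \<forall>i. infdist K (sideline P i) = k * dist (P i) (P (Suc i)))"

(* The common symmedian point of all members of a family of harmonic N-gons. *)
definition family_symmedian_point :: "nat \<Rightarrow> polygon set \<Rightarrow> point" where
  "family_symmedian_point N F = (THE K. \<forall>P\<in>F. harmonic_with_symmedian_point N P K)"

definition polar :: "point \<Rightarrow> real \<Rightarrow> point \<Rightarrow> point set" where
  "polar c r p = {q. (p - c) \<bullet> (q - c) = r\<^sup>2}"

(* Well defined exactly for lines that do not pass through the centre c (for r > 0). *)
definition pole :: "point \<Rightarrow> real \<Rightarrow> point set \<Rightarrow> point" where
  "pole c r L = (THE p. polar c r p = L)"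

definition polar_image :: "point \<Rightarrow> real \<Rightarrow> polygon \<Rightarrow> polygon" where
  "polar_image c r P = (\<lambda>i. pole c r (sideline P i))"

definition ellipse :: "real \<Rightarrow> real \<Rightarrow> real \<Rightarrow> point set" where
  "ellipse xc a b = {(x, y). (x - xc)\<^sup>2 / a\<^sup>2 + y\<^sup>2 / b\<^sup>2 - 1 = 0}"

definition symmetry_center :: "point \<Rightarrow> point set \<Rightarrow> bool" where
  "symmetry_center c S \<longleftrightarrow> (\<lambda>p. 2 *\<^sub>R c - p) ` S = S"

definition concentric :: "point set \<Rightarrow> point set \<Rightarrow> bool" where
  "concentric S T \<longleftrightarrow> (\<exists>c. symmetry_center c S \<and> symmetry_center c T)"

definition homothetic :: "point set \<Rightarrow> point set \<Rightarrow> bool" where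
  "homothetic S T \<longleftrightarrow> (\<exists>c k. k \<noteq> 0 \<and> T = (\<lambda>p. c + k *\<^sub>R (p - c)) ` S)"

(* L is tangent to the curve S at p: it is the line through p spanned by the velocity at p of some
   parametrized curve running in S. *)
definition tangent_line_at :: "point set \<Rightarrow> point \<Rightarrow> point set \<Rightarrow> bool" where
  "tangent_line_at S p L \<longleftrightarrow>
     (\<exists>(\<gamma> :: real \<Rightarrow> point) v. range \<gamma> \<subseteq> S \<and> \<gamma> 0 = p \<and> v \<noteq> 0 \<and>
        (\<gamma> has_vector_derivative v) (at 0) \<and> L = range (\<lambda>s. p + s *\<^sub>R v))"

definition interscribed :: "polygon \<Rightarrow> point set \<Rightarrow> point set \<Rightarrow> bool" where
  "interscribed Q E e \<longleftrightarrow>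
     (\<forall>i. Q i \<in> E) \<and> (\<forall>i. \<exists>p\<in>side Q i. tangent_line_at e p (sideline Q i))"

(* All members are interscribed N-gons, and every point of the outer conic E
   is a vertex of some member. *)
definition poncelet_family :: "nat \<Rightarrow> polygon set \<Rightarrow> point set \<Rightarrow> point set \<Rightarrow> bool" where
  "poncelet_family N F E e \<longleftrightarrow>
     (\<forall>Q\<in>F. ngon N Q \<and> interscribed Q E e) \<and> (\<forall>p\<in>E. \<exists>Q\<in>F. \<exists>i. Q i = p)"

end

theory Submission
  imports Defs
begin

text \<open>Put \<open>s = 1 + x0\<^sup>2\<close>, \<open>m = (1 - x0\<^sup>2) / s\<close> and \<open>D \<phi> = s - 2 * x0 * cos \<phi>\<close>. Relative to
  \<open>centre = (x0 ^ 3 / s, 0)\<close> the inverse of \<open>(cos \<phi>, sin \<phi>)\<close> is \<open>(m * cos \<phi>, sin \<phi>) / D \<phi>\<close>, i.e. on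
  the unit circle the inversion agrees with a projective map taking the origin to \<open>centre\<close>. Weighting
  the vertices by \<open>D\<close> shows that \<open>centre\<close> is interior to every polygon of the family, and the polar
  of a vertex becomes an affine image of a tangent line of the unit circle. Hence the
  polar polygons are images under one fixed affine map of the regular \<open>N\<close>-gons circumscribed about
  the unit circle, whose vertices lie on the circle of radius \<open>1 / cos \<alpha>\<close>.\<close>

section \<open>Lines, distances to lines and interior points of convex hulls\<close>

lemma affine_hull_pair_eq_line:
  fixes a b c n :: point
  assumes "a \<noteq> b" "n \<noteq> 0" "(a - c) \<bullet> n = e" "(b - c) \<bullet> n = e"
  shows "affine hull {a, b} = {x. (x - c) \<bullet> n = e}"
proof -
  have perp: "(b - a) \<bullet> n = 0"
    using assms(3,4) by (simp add: inner_diff_left)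
  have "\<exists>u. x = a + u *\<^sub>R (b - a)" if "(x - c) \<bullet> n = e" for x
  proof -
    obtain n1 n2 d1 d2 y1 y2 where
      eq: "n = (n1, n2)" "b - a = (d1, d2)" "x - a = (y1, y2)"
      by (metis surj_pair)
    have "(x - a) \<bullet> n = 0"
      using assms(3) that by (simp add: inner_diff_left)
    then have y: "y1 * n1 + y2 * n2 = 0" and d: "d1 * n1 + d2 * n2 = 0"
      using perp by (auto simp: eq)
    have "b - a \<noteq> 0"
      using assms(1) by simp
    then have n0: "n1 \<noteq> 0 \<or> n2 \<noteq> 0" and d0: "d1 \<noteq> 0 \<or> d2 \<noteq> 0"
      using assms(2) unfolding eq by (auto simp: zero_prod_def)
    \<comment> \<open>Two vectors of the plane orthogonal to \<open>n\<close> have determinant zero;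
      eliminating the other component of \<open>n\<close> leaves the determinant times
      \<open>n1\<close> or \<open>n2\<close>.\<close>
    have "n1 * (y1 * d2 - y2 * d1) = 0" "n2 * (y1 * d2 - y2 * d1) = 0"
      using y d by algebra+
    with n0 have cross: "y1 * d2 = y2 * d1"
      by auto
    have "\<exists>u. y1 = u * d1 \<and> y2 = u * d2"
    proof (cases "d1 = 0")
      case True
      with d0 cross show ?thesis
        by (intro exI[of _ "y2 / d2"]) auto
    next
      case False
      with cross show ?thesis
        by (intro exI[of _ "y1 / d1"]) (auto simp: field_simps)
    qed
    then obtain u where "x - a = u *\<^sub>R (b - a)"
      by (auto simp: eq)
    then show ?thesis
      by (metis add.commute diff_add_cancel)
  qed
  moreover have "(a + u *\<^sub>R (b - a) - c) \<bullet> n = e" for u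
    using assms(3) perp by (simp add: inner_diff_left inner_add_left)
  ultimately show ?thesis
    unfolding affine_hull_2_alt by blast
qed

lemma infdist_line:
  fixes z c n :: "'a::real_inner"
  assumes "n \<noteq> 0"
  shows "infdist z {x. (x - c) \<bullet> n = e} = \<bar>(z - c) \<bullet> n - e\<bar> / norm n"
proof -
  let ?L = "{x. (x - c) \<bullet> n = e}"
  \<comment> \<open>\<open>f\<close> is the foot of the perpendicular from \<open>z\<close>;
    Cauchy-Schwarz then shows that no point of the line is nearer.\<close>
  define f where "f = z - (((z - c) \<bullet> n - e) / (n \<bullet> n)) *\<^sub>R n"
  have f: "f \<in> ?L"
    using assms by (simp add: f_def inner_diff_left)
  have "dist z f = \<bar>(z - c) \<bullet> n - e\<bar> / (n \<bullet> n) * norm n"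
    by (simp add: f_def dist_norm)
  also have "\<dots> = \<bar>(z - c) \<bullet> n - e\<bar> / norm n"
    by (simp add: dot_square_norm power2_eq_square)
  finally have df: "dist z f = \<bar>(z - c) \<bullet> n - e\<bar> / norm n" .
  have "\<bar>(z - c) \<bullet> n - e\<bar> / norm n \<le> dist z x" if "x \<in> ?L" for x
  proof -
    have "(z - c) \<bullet> n - e = (z - x) \<bullet> n"
      using that by (auto simp: inner_diff_left)
    then show ?thesis
      using Cauchy_Schwarz_ineq2[of "z - x" n] assms by (simp add: dist_norm field_simps)
  qed
  then have "\<bar>(z - c) \<bullet> n - e\<bar> / norm n \<le> infdist z ?L"
    using f by (auto simp: infdist_def intro!: cINF_greatest)
  with infdist_le[OF f, of z] df show ?thesis
    by simp
qed

text \<open>A hyperplane supporting the hull at \<open>z\<close> would have all \<open>p i\<close>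
  on one side; as the positively weighted sum vanishes, all of them would lie on it, which the last
  assumption forbids.\<close>

lemma weighted_centroid_in_interior_convex_hull:
  fixes p :: "'i \<Rightarrow> 'a::euclidean_space"
  assumes "finite I" "I \<noteq> {}"
    and pos: "\<And>i. i \<in> I \<Longrightarrow> w i > 0"
    and zero: "(\<Sum>i\<in>I. w i *\<^sub>R (p i - z)) = 0"
    and span: "\<And>a. (\<And>i. i \<in> I \<Longrightarrow> a \<bullet> (p i - z) = 0) \<Longrightarrow> a = 0"
  shows "z \<in> interior (convex hull (p ` I))"
proof -
  let ?S = "convex hull (p ` I)"
  have wpos: "sum w I > 0"
    using assms(1,2) pos by (simp add: sum_pos)
  have "(\<Sum>i\<in>I. w i *\<^sub>R p i) = sum w I *\<^sub>R z"
    using zero by (simp add: scaleR_diff_right sum_subtractf flip: scaleR_left.sum)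
  then have "z = (\<Sum>i\<in>I. (w i / sum w I) *\<^sub>R p i)"
    using wpos by (simp add: divide_inverse_commute flip: scaleR_scaleR scaleR_right.sum) simp
  moreover have "(\<Sum>i\<in>I. (w i / sum w I) *\<^sub>R p i) \<in> ?S"
  proof (rule convex_sum)
    show "(\<Sum>i\<in>I. w i / sum w I) = 1"
      using wpos by (simp flip: sum_divide_distrib)
  qed (use assms(1) wpos pos in \<open>auto intro!: hull_inc divide_nonneg_pos less_imp_le\<close>)
  ultimately have z: "z \<in> ?S"
    by simp
  have no_support: "a = 0" if le: "\<And>y. y \<in> ?S \<Longrightarrow> a \<bullet> z \<le> a \<bullet> y" for a
  proof (rule span)
    fix i assume i: "i \<in> I"
    have nonneg: "a \<bullet> (p j - z) \<ge> 0" if "j \<in> I" for j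
      using le[of "p j"] that by (simp add: inner_diff_right hull_inc)
    have "(\<Sum>j\<in>I. w j * (a \<bullet> (p j - z))) = a \<bullet> (\<Sum>j\<in>I. w j *\<^sub>R (p j - z))"
      by (simp add: inner_sum_right)
    then have "(\<Sum>j\<in>I. w j * (a \<bullet> (p j - z))) = 0"
      by (simp add: zero)
    then have "w i * (a \<bullet> (p i - z)) = 0"
      using assms(1) i nonneg less_imp_le[OF pos]
      by (subst (asm) sum_nonneg_eq_0_iff) (auto intro!: mult_nonneg_nonneg)
    with pos[OF i] show "a \<bullet> (p i - z) = 0"
      by simp
  qed
  show ?thesis
  proof (rule ccontr)
    assume notin: "z \<notin> interior ?S"
    show False
    proof (cases "interior ?S = {}")
      case True
      \<comment> \<open>A flat hull lies in a hyperplane, whose normal is trivially a supporting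
        direction.\<close>
      then obtain a b where "a \<noteq> 0" "?S \<subseteq> {x. a \<bullet> x = b}"
        using empty_interior_subset_hyperplane[OF convex_convex_hull] by metis
      then have "a \<bullet> z \<le> a \<bullet> y" if "y \<in> ?S" for y
        using that z by (metis (mono_tags, lifting) mem_Collect_eq order_refl subsetD)
      then show False
        using no_support[of a] \<open>a \<noteq> 0\<close> by auto
    next
      case False
      then have "z \<notin> rel_interior ?S"
        using notin by (simp add: rel_interior_nonempty_interior)
      then obtain a where "a \<noteq> 0" "\<And>y. y \<in> ?S \<Longrightarrow> a \<bullet> z \<le> a \<bullet> y"
        using supporting_hyperplane_rel_boundary[OF convex_convex_hull z] by metis
      then show False
        using no_support[of a] by auto
    qed
  qed
qed

section \<open>Ellipses and their tangent lines\<close>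

lemma ellipse_iff_param:
  assumes "a \<noteq> 0" "b \<noteq> 0"
  shows "p \<in> ellipse xc a b \<longleftrightarrow> (\<exists>\<phi>. p = (xc + a * cos \<phi>, b * sin \<phi>))"
proof
  assume "p \<in> ellipse xc a b"
  then have "((fst p - xc) / a)\<^sup>2 + (snd p / b)\<^sup>2 = 1"
    by (auto simp: ellipse_def power_divide)
  then obtain \<phi> where "(fst p - xc) / a = cos \<phi>" "snd p / b = sin \<phi>"
    using sincos_total_2pi by metis
  then have "p = (xc + a * cos \<phi>, b * sin \<phi>)"
    using assms by (auto simp: prod_eq_iff field_simps)
  then show "\<exists>\<phi>. p = (xc + a * cos \<phi>, b * sin \<phi>)" ..
next
  assume "\<exists>\<phi>. p = (xc + a * cos \<phi>, b * sin \<phi>)"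
  then show "p \<in> ellipse xc a b"
    using assms by (auto simp: ellipse_def power_mult_distrib)
qed

lemma homothetic_ellipse:
  assumes "k \<noteq> 0"
  shows "homothetic (ellipse xc a b) (ellipse xc (k * a) (k * b))"
proof -
  have "ellipse xc (k * a) (k * b) = (\<lambda>p. (xc, 0) + k *\<^sub>R (p - (xc, 0))) ` ellipse xc a b"
    (is "?E = ?f ` _")
  proof (intro equalityI subsetI)
    fix p assume p: "p \<in> ?E"
    define q where "q = (xc, 0) + (1 / k) *\<^sub>R (p - (xc, 0))"
    have "q \<in> ellipse xc a b"
      using p assms by (auto simp: q_def ellipse_def power_divide power_mult_distrib)
    moreover have "p = ?f q"
      using assms by (simp add: q_def)
    ultimately show "p \<in> ?f ` ellipse xc a b"
      by blast
  qed (use assms in \<open>auto simp: ellipse_def power_mult_distrib\<close>)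
  with assms show ?thesis
    unfolding homothetic_def by blast
qed

lemma symmetry_center_ellipse: "symmetry_center (xc, 0) (ellipse xc a b)"
proof -
  have sub: "(\<lambda>p. 2 *\<^sub>R (xc, 0) - p) ` ellipse xc a b \<subseteq> ellipse xc a b"
    by (auto simp: ellipse_def power2_commute)
  \<comment> \<open>The reflection is an involution, so the inclusion \<open>sub\<close> already
    yields equality.\<close>
  have "p \<in> (\<lambda>p. 2 *\<^sub>R (xc, 0) - p) ` ellipse xc a b" if "p \<in> ellipse xc a b" for p
    using sub that by (intro image_eqI[of _ _ "2 *\<^sub>R (xc, 0) - p"]) auto
  with sub show ?thesis
    unfolding symmetry_center_def by blast
qed

lemma tangent_line_ellipse:
  assumes "a \<noteq> 0" "b \<noteq> 0"
  shows "tangent_line_at (ellipse xc a b) (xc + a * cos \<phi>, b * sin \<phi>)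
    (range (\<lambda>s. (xc + a * cos \<phi>, b * sin \<phi>) + s *\<^sub>R (- a * sin \<phi>, b * cos \<phi>)))"
proof -
  \<comment> \<open>The angle is shifted by \<phi> so that the curve passes the contact point at
    parameter 0.\<close>
  let ?g = "\<lambda>\<tau>. (xc + a * cos (\<phi> + \<tau>), b * sin (\<phi> + \<tau>))"
  have "range ?g \<subseteq> ellipse xc a b"
    using assms by (auto simp: ellipse_iff_param)
  moreover have "(?g has_vector_derivative (- a * sin \<phi>, b * cos \<phi>)) (at 0)"
    by (intro has_vector_derivative_Pair)
      (auto intro!: derivative_eq_intros simp flip: has_real_derivative_iff_has_vector_derivative)
  moreover have "(- a * sin \<phi>, b * cos \<phi>) \<noteq> 0"
    using assms sin_zero_abs_cos_one[of \<phi>] by (auto simp: zero_prod_def)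
  ultimately show ?thesis
    unfolding tangent_line_at_def by (intro exI[of _ ?g] exI conjI) auto
qed

text \<open>Brings the line through two points symmetric about \<open>p\<close> into the form that
  \<open>tangent_line_at\<close> asks for.\<close>

lemma affine_hull_symmetric_pair:
  assumes "r \<noteq> 0"
  shows "affine hull {p - r *\<^sub>R v, p + r *\<^sub>R v} = range (\<lambda>s. p + s *\<^sub>R v)"
proof -
  have *: "p - r *\<^sub>R v + u *\<^sub>R (p + r *\<^sub>R v - (p - r *\<^sub>R v)) = p + (2 * u * r - r) *\<^sub>R v" for u
  proof -
    have "p + r *\<^sub>R v - (p - r *\<^sub>R v) = (2 * r) *\<^sub>R v"
      by (simp flip: scaleR_left_distrib)
    then show ?thesis
      by (simp add: scaleR_left_diff_distrib algebra_simps)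
  qed
  have "p + s *\<^sub>R v \<in> range (\<lambda>u. p + (2 * u * r - r) *\<^sub>R v)" for s
  proof (rule range_eqI)
    have "s = 2 * ((s + r) / (2 * r)) * r - r"
      using assms by (simp add: field_simps)
    then show "p + s *\<^sub>R v = p + (2 * ((s + r) / (2 * r)) * r - r) *\<^sub>R v"
      by (rule arg_cong)
  qed
  then show ?thesis
    unfolding affine_hull_2_alt * by blast
qed

section \<open>Trigonometry of regular polygons\<close>

text \<open>Multiples of \<open>2 * pi\<close> are even multiples of \<open>pi / N\<close>, so an
  odd multiple stays at least \<open>pi / N\<close> away from each of them.\<close>

lemma cos_odd_multiple_le:
  fixes k :: int
  assumes "N \<ge> 1"
  shows "cos (of_int (2 * k + 1) * (pi / real N)) \<le> cos (pi / real N)"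
proof -
  define r where "r = k mod int N"
  have r: "0 \<le> r" "r < int N" and k: "k = r + int N * (k div int N)"
    using assms by (auto simp: r_def)
  let ?x = "of_int (2 * r + 1) * (pi / real N)"
  have "real_of_int k = of_int r + real N * of_int (k div int N)"
    by (subst k) simp
  then have "of_int (2 * k + 1) * (pi / real N) = ?x + 2 * pi * of_int (k div int N)"
    using assms by (simp add: field_simps)
  then have eq: "cos (of_int (2 * k + 1) * (pi / real N)) = cos ?x"
    by (simp only: cos_add sin_int_2pin cos_int_2pin)
  have lo: "pi / real N \<le> ?x"
    using r assms by (simp add: field_simps)
  \<comment> \<open>The reflected angle is again an odd multiple, which gives the lower bound needed
    when \<open>?x\<close> exceeds \<open>pi\<close>.\<close>
  have "?x = 2 * pi - of_int (2 * (int N - 1 - r) + 1) * (pi / real N)"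
    using assms by (simp add: field_simps)
  moreover have "pi / real N \<le> of_int (2 * (int N - 1 - r) + 1) * (pi / real N)"
  proof -
    have "(1::real) \<le> of_int (2 * (int N - 1 - r) + 1)"
      using r by (subst of_int_1_le_iff) simp
    from mult_right_mono[OF this, of "pi / real N"] show ?thesis
      by simp
  qed
  ultimately have hi: "pi / real N \<le> 2 * pi - ?x"
    by linarith
  have "cos ?x \<le> cos (pi / real N)"
  proof (cases "?x \<le> pi")
    case True
    then show ?thesis
      using lo by (intro cos_monotone_0_pi_le) auto
  next
    case False
    then have "cos (2 * pi - ?x) \<le> cos (pi / real N)"
      using hi by (intro cos_monotone_0_pi_le) auto
    then show ?thesis
      by simp
  qed
  with eq show ?thesis
    by simp
qed

lemma regular_angle_inj:
  assumes "i \<in> {1..N}" "j \<in> {1..N}"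
    and "cos (2 * (pi / real N) * real i + t) = cos (2 * (pi / real N) * real j + t)"
    and "sin (2 * (pi / real N) * real i + t) = sin (2 * (pi / real N) * real j + t)"
  shows "i = j"
proof -
  obtain n :: int where
    *: "2 * (pi / real N) * real i + t = 2 * (pi / real N) * real j + t + 2 * pi * n"
    using assms(3,4) sin_cos_eq_iff by metis
  then have "real i = real j + real N * of_int n"
  proof -
    have "2 * pi / real N * (real i - real j) = 2 * pi * of_int n"
      using * by (simp only: right_diff_distrib)
    then show ?thesis
      using assms(1) by (simp add: divide_simps) (simp add: algebra_simps)
  qed
  then have n: "int i - int j = int N * n"
  proof -
    have "real_of_int (int i) = real_of_int (int j + int N * n)"
      using \<open>real i = _\<close> by simp
    then show ?thesis
      by linarith
  qed
  have "\<bar>int i - int j\<bar> < int N"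
    using assms(1,2) by auto
  with n dvd_imp_le_int[of "int i - int j" "int N"] have "int i - int j = 0"
    by fastforce
  then show ?thesis
    by simp
qed

text \<open>Multiplied by \<open>2 * sin a\<close>, each term becomes a difference of values half a
  step, \<open>a\<close>, on either side of its angle, and the sum telescopes over a full
  turn.\<close>

lemma sum_regular_angles:
  assumes "N \<ge> 2"
  shows "(\<Sum>i=1..N. cos (2 * (pi / real N) * real i + t)) = 0"
    and "(\<Sum>i=1..N. sin (2 * (pi / real N) * real i + t)) = 0"
proof -
  define a where "a = pi / real N"
  have sa: "sin a \<noteq> 0"
    using assms by (intro less_imp_neq[symmetric] sin_gt_zero) (auto simp: a_def field_simps)
  have per: "2 * a * real N = 2 * pi"
    using assms by (simp add: a_def)
  define x where "x = (\<lambda>i. 2 * a * real i + t)"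
  define C where "C = (\<lambda>i::nat. cos (x i + a))"
  define S where "S = (\<lambda>i::nat. sin (x i + a))"
  have prev: "x (i - 1) + a = x i - a" if "i \<in> {1..N}" for i
    using that by (simp add: x_def of_nat_diff algebra_simps)
  have prevS: "S (i - 1) = sin (x i - a)" and prevC: "C (i - 1) = cos (x i - a)" if "i \<in> {1..N}" for i
    using that by (simp_all only: S_def C_def prev)
  have "2 * sin a * (\<Sum>i=1..N. cos (x i)) = (\<Sum>i=1..N. S i - S (i - 1))"
    unfolding sum_distrib_left
    by (intro sum.cong refl) (simp only: prevS, simp add: S_def sin_add sin_diff)
  also have "\<dots> = S N - S 0"
    using sum_telescope''[of 0 N S] by (simp add: atLeastSucAtMost_greaterThanAtMost)
  also have "\<dots> = 0"
    using sin_periodic[of "t + a"] cos_periodic[of "t + a"] by (simp add: S_def x_def per add_ac)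
  finally show "(\<Sum>i=1..N. cos (2 * (pi / real N) * real i + t)) = 0"
    using sa by (simp add: a_def x_def)
  have "2 * sin a * (\<Sum>i=1..N. sin (x i)) = (\<Sum>i=1..N. - C i - (- C (i - 1)))"
    unfolding sum_distrib_left
    by (intro sum.cong refl) (simp only: prevC, simp add: C_def cos_add cos_diff)
  also have "\<dots> = - C N - (- C 0)"
    using sum_telescope''[of 0 N "\<lambda>i. - C i"] by (simp add: atLeastSucAtMost_greaterThanAtMost)
  also have "\<dots> = 0"
    using sin_periodic[of "t + a"] cos_periodic[of "t + a"] by (simp add: C_def x_def per add_ac)
  finally show "(\<Sum>i=1..N. sin (2 * (pi / real N) * real i + t)) = 0"
    using sa by (simp add: a_def x_def)
qed

text \<open>A linear form vanishing on two unit vectors is zero if their determinant, here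
  \<open>sin \<delta>\<close>, is nonzero.\<close>

lemma trig_form_eq_0:
  fixes a b :: real
  assumes "a * cos \<theta> + b * sin \<theta> = 0" "a * cos (\<theta> + \<delta>) + b * sin (\<theta> + \<delta>) = 0" "sin \<delta> \<noteq> 0"
  shows "a = 0" "b = 0"
proof -
  have *: "a * (cos \<theta> * cos \<delta> - sin \<theta> * sin \<delta>) + b * (sin \<theta> * cos \<delta> + cos \<theta> * sin \<delta>) = 0"
    using assms(2) by (simp add: cos_add sin_add)
  have 1: "(sin \<theta>)\<^sup>2 + (cos \<theta>)\<^sup>2 = 1"
    by simp
  have "a * sin \<delta> = 0"
    using * assms(1) 1 by algebra
  moreover have "b * sin \<delta> = 0"
    using * assms(1) 1 by algebra
  ultimately show "a = 0" "b = 0"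
    using assms(3) by auto
qed


section \<open>The inverted polygons and their sidelines in coordinates about
  \<open>centre\<close>\<close>

locale inverted_regular_ngons =
  fixes N :: nat and x0 :: real
  assumes N_ge_3: "N \<ge> 3" and x0_sq: "x0\<^sup>2 \<noteq> 1"
begin

definition \<alpha> :: real where "\<alpha> = pi / real N"

definition s :: real where "s = 1 + x0\<^sup>2"

definition m :: real where "m = (1 - x0\<^sup>2) / s"

definition \<theta> :: "real \<Rightarrow> nat \<Rightarrow> real" where "\<theta> t i = 2 * \<alpha> * real i + t"

text \<open>The squared distance of the point of the unit circle at angle \<open>\<phi>\<close> to the centre of inversion.\<close>

definition D :: "real \<Rightarrow> real" where "D \<phi> = s - 2 * x0 * cos \<phi>"

definition centre :: point where "centre = (x0 ^ 3 / s, 0)"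

text \<open>Inversion takes the chord of the unit circle that subtends the angle \<open>2 * \<alpha>\<close> and has its
  midpoint at angle \<open>\<phi>\<close> to a pair of points whose line has the equation
  \<open>(x - centre) \<bullet> normal \<phi> = 1\<close>.\<close>

definition normal :: "real \<Rightarrow> point" where
  "normal \<phi> = ((s * cos \<phi> / cos \<alpha> - 2 * x0) / m, s * sin \<phi> / cos \<alpha>)"

lemma s_pos: "s > 0"
  by (simp add: s_def add_pos_nonneg)

lemma m_nonzero: "m \<noteq> 0"
  using s_pos x0_sq by (simp add: m_def)

lemma \<alpha>_bounds: "0 < \<alpha>" "2 * \<alpha> < pi"
  using N_ge_3 by (auto simp: \<alpha>_def field_simps)

lemma sin_\<alpha>: "sin \<alpha> > 0" and cos_\<alpha>: "cos \<alpha> > 0" and sin_2\<alpha>: "sin (2 * \<alpha>) > 0"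
  using \<alpha>_bounds by (auto intro!: sin_gt_zero cos_gt_zero)

text \<open>The centre of inversion is not on the unit circle because
  \<open>x0\<^sup>2 \<noteq> 1\<close>.\<close>

lemma D_pos: "D \<phi> > 0"
proof -
  have "D \<phi> = (x0 - cos \<phi>)\<^sup>2 + (sin \<phi>)\<^sup>2"
    by (simp add: D_def s_def power2_eq_square algebra_simps sin_squared_eq)
  moreover have "x0 \<noteq> cos \<phi>" if "sin \<phi> = 0"
    using that x0_sq by (metis power_zero_numeral sin_cos_squared_add add_0)
  ultimately show ?thesis
    by (cases "sin \<phi> = 0") (auto intro: add_nonneg_pos)
qed

lemma \<theta>_Suc: "\<theta> t (Suc i) = \<theta> t i + 2 * \<alpha>"
  by (simp add: \<theta>_def algebra_simps)

lemma regular_ngon_eq: "regular_ngon N t i = (cos (\<theta> t i), sin (\<theta> t i))"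
  by (simp add: regular_ngon_def \<theta>_def \<alpha>_def)

lemma \<theta>_inj:
  assumes "i \<in> {1..N}" "j \<in> {1..N}"
    and "cos (\<theta> t i) = cos (\<theta> t j)" "sin (\<theta> t i) = sin (\<theta> t j)"
  shows "i = j"
  using regular_angle_inj[of i N j t] assms by (simp add: \<theta>_def \<alpha>_def)

lemma \<theta>_period: "\<theta> t (i + N) = \<theta> t i + 2 * pi"
  using N_ge_3 by (simp add: \<theta>_def \<alpha>_def field_simps)

lemma norm_regular: "(norm ((cos \<phi>, sin \<phi>) - (x0, 0)))\<^sup>2 = D \<phi>"
proof -
  have "(norm ((cos \<phi>, sin \<phi>) - (x0, 0)))\<^sup>2 = (cos \<phi> - x0)\<^sup>2 + (sin \<phi>)\<^sup>2"
    by (simp add: norm_Pair)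
  also have "\<dots> = D \<phi>"
    using sin_cos_squared_add[of \<phi>] unfolding D_def s_def by algebra
  finally show ?thesis .
qed

lemma harmonic_ngon_eq:
  "harmonic_ngon N x0 t i = (x0 + (cos (\<theta> t i) - x0) / D (\<theta> t i), sin (\<theta> t i) / D (\<theta> t i))"
  by (simp add: harmonic_ngon_def inversion_def regular_ngon_eq norm_regular[simplified])

lemma harmonic_ngon_minus_centre:
  "harmonic_ngon N x0 t i - centre =
    (m * cos (\<theta> t i) / D (\<theta> t i), sin (\<theta> t i) / D (\<theta> t i))"
proof -
  have "x0 - x0 ^ 3 / s = x0 / s"
    using s_pos by (simp add: field_simps) (simp add: s_def power3_eq_cube power2_eq_square algebra_simps)
  moreover have "x0 / s + (cos \<phi> - x0) / D \<phi> = (1 - x0\<^sup>2) * cos \<phi> / (s * D \<phi>)" for \<phi>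
  proof -
    have "x0 / s + (cos \<phi> - x0) / D \<phi> = (x0 * D \<phi> + s * (cos \<phi> - x0)) / (s * D \<phi>)"
      using s_pos D_pos[of \<phi>] by (simp add: field_simps)
    also have "x0 * D \<phi> + s * (cos \<phi> - x0) = (1 - x0\<^sup>2) * cos \<phi>"
      unfolding D_def s_def by algebra
    finally show ?thesis .
  qed
  ultimately have "x0 + (cos \<phi> - x0) / D \<phi> - x0 ^ 3 / s = (1 - x0\<^sup>2) * cos \<phi> / (s * D \<phi>)" for \<phi>
    by (metis add.commute add_diff_eq)
  then show ?thesis
    by (simp add: harmonic_ngon_eq centre_def m_def)
qed

text \<open>After multiplication by \<open>D\<close>, the position of a vertex relative to a line
  depends only on how \<open>cos (\<theta> t i - \<phi>)\<close> compares with
  \<open>cos \<alpha>\<close>.\<close>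

lemma harmonic_ngon_inner_normal:
  "D (\<theta> t i) * ((harmonic_ngon N x0 t i - centre) \<bullet> normal \<phi>) =
    D (\<theta> t i) - s * (1 - cos (\<theta> t i - \<phi>) / cos \<alpha>)"
proof -
  define \<psi> where "\<psi> = \<theta> t i"
  have "D \<psi> * (m * cos \<psi> / D \<psi> * ((s * cos \<phi> / cos \<alpha> - 2 * x0) / m) +
      sin \<psi> / D \<psi> * (s * sin \<phi> / cos \<alpha>)) =
    cos \<psi> * (s * cos \<phi> / cos \<alpha> - 2 * x0) + sin \<psi> * (s * sin \<phi> / cos \<alpha>)"
    using D_pos[of \<psi>] m_nonzero by (simp add: distrib_left)
  also have "\<dots> = D \<psi> - s * (1 - cos (\<psi> - \<phi>) / cos \<alpha>)"
    by (simp add: D_def cos_diff add_divide_distrib algebra_simps)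
  finally show ?thesis
    by (simp add: harmonic_ngon_minus_centre normal_def flip: \<psi>_def)
qed

lemma harmonic_ngon_on_line:
  "(harmonic_ngon N x0 t i - centre) \<bullet> normal (\<theta> t i + \<alpha>) = 1"
  "(harmonic_ngon N x0 t (Suc i) - centre) \<bullet> normal (\<theta> t i + \<alpha>) = 1"
proof -
  show "(harmonic_ngon N x0 t i - centre) \<bullet> normal (\<theta> t i + \<alpha>) = 1"
    using harmonic_ngon_inner_normal[of t i "\<theta> t i + \<alpha>"] D_pos[of "\<theta> t i"] cos_\<alpha> by simp
  show "(harmonic_ngon N x0 t (Suc i) - centre) \<bullet> normal (\<theta> t i + \<alpha>) = 1"
    using harmonic_ngon_inner_normal[of t "Suc i" "\<theta> t i + \<alpha>"] D_pos[of "\<theta> t (Suc i)"] cos_\<alpha>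
    by (simp add: \<theta>_Suc)
qed

lemma harmonic_ngon_halfplane:
  "(harmonic_ngon N x0 t j - centre) \<bullet> normal (\<theta> t i + \<alpha>) \<le> 1"
proof -
  \<comment> \<open>Vertex angles differ from the mid-angle of a side by odd multiples of \<alpha>;
    the \<open>- 1\<close> absorbs the half step from vertex \<open>i\<close> to that
    mid-angle.\<close>
  have "\<theta> t j - (\<theta> t i + \<alpha>) = of_int (2 * (int j - int i - 1) + 1) * (pi / real N)"
    by (simp add: \<theta>_def flip: \<alpha>_def) (simp add: algebra_simps)
  then have "cos (\<theta> t j - (\<theta> t i + \<alpha>)) \<le> cos \<alpha>"
    using cos_odd_multiple_le[of N "int j - int i - 1"] N_ge_3 by (simp only: \<alpha>_def)
  then have "s * (1 - cos (\<theta> t j - (\<theta> t i + \<alpha>)) / cos \<alpha>) \<ge> 0"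
    using s_pos cos_\<alpha> by simp
  then have "D (\<theta> t j) * ((harmonic_ngon N x0 t j - centre) \<bullet> normal (\<theta> t i + \<alpha>)) \<le> D (\<theta> t j) * 1"
    by (simp add: harmonic_ngon_inner_normal)
  then show ?thesis
    using D_pos[of "\<theta> t j"] by (simp only: mult_le_cancel_left_pos)
qed

text \<open>Seen from \<open>centre\<close>, consecutive vertices are linearly independent: up to
  the scalings by \<open>m\<close> and \<open>D\<close> they are unit vectors at the angle
  \<open>2 * \<alpha>\<close>, whose sine is positive.\<close>

lemma orthogonal_consecutive_vertices:
  assumes "a \<bullet> (harmonic_ngon N x0 t i - centre) = 0"
    and "a \<bullet> (harmonic_ngon N x0 t (Suc i) - centre) = 0"
  shows "a = 0"
proof -
  obtain a1 a2 where a: "a = (a1, a2)"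
    by (cases a)
  have "(a1 * m) * cos (\<theta> t j) + a2 * sin (\<theta> t j) = 0"
    if "a \<bullet> (harmonic_ngon N x0 t j - centre) = 0" for j
    using that D_pos[of "\<theta> t j"]
    by (simp add: a harmonic_ngon_minus_centre flip: add_divide_distrib)
  from this[OF assms(1)] this[OF assms(2)] have "a1 * m = 0" "a2 = 0"
    using trig_form_eq_0[of "a1 * m" "\<theta> t i" a2 "2 * \<alpha>"] sin_2\<alpha> by (auto simp: \<theta>_Suc)
  then show ?thesis
    using m_nonzero by (simp add: a zero_prod_def)
qed

lemma normal_nonzero: "normal (\<theta> t i + \<alpha>) \<noteq> 0"
  using harmonic_ngon_on_line(1)[of t i] by force

section \<open>Harmonicity and the common symmedian point\<close>

lemma ngon_harmonic_ngon: "ngon N (harmonic_ngon N x0 t)"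
  unfolding ngon_def
proof (intro conjI allI inj_onI)
  show "harmonic_ngon N x0 t (i + N) = harmonic_ngon N x0 t i" for i
    by (simp add: harmonic_ngon_eq \<theta>_period D_def)
  fix i j assume ij: "i \<in> {1..N}" "j \<in> {1..N}"
    and eq: "harmonic_ngon N x0 t i = harmonic_ngon N x0 t j"
  let ?p = "\<lambda>i. harmonic_ngon N x0 t i - (x0, 0)"
  \<comment> \<open>The distance of an inverted point from the centre of inversion determines
    \<open>D\<close>, and with it the original point.\<close>
  have norm_p: "(norm (?p k))\<^sup>2 * D (\<theta> t k) = 1" for k
  proof -
    have "?p k = (1 / D (\<theta> t k)) *\<^sub>R ((cos (\<theta> t k), sin (\<theta> t k)) - (x0, 0))"
      by (simp add: harmonic_ngon_eq)
    then have "(norm (?p k))\<^sup>2 = (1 / D (\<theta> t k))\<^sup>2 * D (\<theta> t k)"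
      using norm_regular[of "\<theta> t k"] by (simp only: norm_scaleR power_mult_distrib power2_abs)
    then show ?thesis
      using D_pos[of "\<theta> t k"] by (simp add: power2_eq_square)
  qed
  have D_eq: "D (\<theta> t i) = D (\<theta> t j)"
    using norm_p[of i] norm_p[of j] eq by (metis mult_cancel_left mult_zero_left zero_neq_one)
  then have "cos (\<theta> t i) = cos (\<theta> t j)" "sin (\<theta> t i) = sin (\<theta> t j)"
    using eq D_pos[of "\<theta> t j"] by (auto simp: harmonic_ngon_eq)
  with ij show "i = j"
    by (rule \<theta>_inj)
qed

lemma harmonic_ngon_cocircular: "\<exists>c r. \<forall>i. dist c (harmonic_ngon N x0 t i) = r"
proof (intro exI allI)
  fix i
  \<comment> \<open>\<open>e\<close> is the power of \<open>(x0, 0)\<close> with respect to the unit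
    circle; the image circle has centre \<open>(x0 - x0 / e, 0)\<close> and radius
    \<open>\<bar>1 / e\<bar>\<close>.\<close>
  define e where "e = x0\<^sup>2 - 1"
  define d where "d = D (\<theta> t i)"
  let ?x = "(cos (\<theta> t i) - x0) / d + x0 / e" and ?y = "sin (\<theta> t i) / d"
  have nz: "e \<noteq> 0" "d \<noteq> 0"
    using x0_sq D_pos[of "\<theta> t i"] by (auto simp: e_def d_def)
  have "?x = ((cos (\<theta> t i) - x0) * e + x0 * d) / (d * e)"
    using nz by (simp add: field_simps)
  moreover have "?y = sin (\<theta> t i) * e / (d * e)"
    using nz by simp
  ultimately have "?x\<^sup>2 + ?y\<^sup>2 = (((cos (\<theta> t i) - x0) * e + x0 * d)\<^sup>2 + (sin (\<theta> t i) * e)\<^sup>2) / (d * e)\<^sup>2"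
    by (simp only: power_divide add_divide_distrib[of "_\<^sup>2"])
  also have "((cos (\<theta> t i) - x0) * e + x0 * d)\<^sup>2 + (sin (\<theta> t i) * e)\<^sup>2 = d\<^sup>2"
    using sin_cos_squared_add[of "\<theta> t i"] unfolding e_def d_def D_def s_def by algebra
  finally have "?x\<^sup>2 + ?y\<^sup>2 = (1 / e)\<^sup>2"
    using nz by (simp add: power_divide power_mult_distrib)
  then show "dist (x0 - x0 / e, 0) (harmonic_ngon N x0 t i) = \<bar>1 / e\<bar>"
    by (subst dist_commute)
      (simp only: dist_norm harmonic_ngon_eq norm_Pair diff_Pair real_norm_def power2_abs diff_0_right
        add_diff_add diff_diff_eq2 add_diff_cancel_left' real_sqrt_abs flip: d_def, simp)
qed

lemma centre_in_interior:
  "centre \<in> interior (convex hull (harmonic_ngon N x0 t ` {1..N}))"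
proof (rule weighted_centroid_in_interior_convex_hull)
  have "(\<Sum>i=1..N. D (\<theta> t i) *\<^sub>R (harmonic_ngon N x0 t i - centre)) =
      (\<Sum>i=1..N. (m * cos (\<theta> t i), sin (\<theta> t i)))"
    using D_pos by (intro sum.cong refl) (simp add: harmonic_ngon_minus_centre less_imp_neq[symmetric])
  also have "\<dots> = 0"
    using sum_regular_angles[of N t] N_ge_3
    by (simp add: prod_eq_iff fst_sum snd_sum \<theta>_def \<alpha>_def flip: sum_distrib_left)
  finally show "(\<Sum>i=1..N. D (\<theta> t i) *\<^sub>R (harmonic_ngon N x0 t i - centre)) = 0" .
  show "a = 0" if "\<And>i. i \<in> {1..N} \<Longrightarrow> a \<bullet> (harmonic_ngon N x0 t i - centre) = 0" for a
    using that[of 1] that[of "Suc 1"] N_ge_3 by (intro orthogonal_consecutive_vertices[of a t 1]) auto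
qed (use N_ge_3 D_pos in auto)

lemma harmonic_ngon_neq_Suc: "harmonic_ngon N x0 t i \<noteq> harmonic_ngon N x0 t (Suc i)"
proof
  let ?P = "harmonic_ngon N x0 t"
  assume eq: "?P i = ?P (Suc i)"
  obtain p1 p2 where p: "?P i - centre = (p1, p2)"
    by (cases "?P i - centre")
  \<comment> \<open>If the two vertices coincided, the quarter turn of their common position vector
    would be orthogonal to both.\<close>
  have "(- p2, p1) \<bullet> (?P i - centre) = 0"
    by (simp add: p)
  then have "(- p2, p1) = (0 :: point)"
    using eq by (intro orthogonal_consecutive_vertices[of _ t i]) auto
  then have "?P i - centre = 0"
    by (simp add: p zero_prod_def)
  then show False
    using harmonic_ngon_on_line(1)[of t i] by simp
qed

lemma sideline_eq:
  "sideline (harmonic_ngon N x0 t) i = {x. (x - centre) \<bullet> normal (\<theta> t i + \<alpha>) = 1}"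
  unfolding sideline_def
  by (rule affine_hull_pair_eq_line[OF harmonic_ngon_neq_Suc normal_nonzero harmonic_ngon_on_line])

text \<open>The same product of \<open>D\<close> values occurs in \<open>dist_consecutive\<close>,
  so it cancels from the product of sidelength and norm of the normal.\<close>

lemma norm_normal:
  "(m * cos \<alpha> * norm (normal (\<theta> t i + \<alpha>)))\<^sup>2 = D (\<theta> t i) * D (\<theta> t (Suc i))"
proof -
  define \<beta> where "\<beta> = \<theta> t i + \<alpha>"
  have "(m * cos \<alpha> * norm (normal \<beta>))\<^sup>2 =
      (m * cos \<alpha> * ((s * cos \<beta> / cos \<alpha> - 2 * x0) / m))\<^sup>2 + (m * cos \<alpha> * (s * sin \<beta> / cos \<alpha>))\<^sup>2"
    by (simp add: normal_def norm_Pair power_mult_distrib power_divide distrib_left)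
  also have "m * cos \<alpha> * ((s * cos \<beta> / cos \<alpha> - 2 * x0) / m) = s * cos \<beta> - 2 * x0 * cos \<alpha>"
    using m_nonzero cos_\<alpha> by (simp add: field_simps)
  also have "m * cos \<alpha> * (s * sin \<beta> / cos \<alpha>) = (1 - x0\<^sup>2) * sin \<beta>"
    using s_pos cos_\<alpha> by (simp add: m_def)
  also have "(s * cos \<beta> - 2 * x0 * cos \<alpha>)\<^sup>2 + ((1 - x0\<^sup>2) * sin \<beta>)\<^sup>2 =
      (s - 2 * x0 * (cos \<beta> * cos \<alpha> + sin \<beta> * sin \<alpha>)) * (s - 2 * x0 * (cos \<beta> * cos \<alpha> - sin \<beta> * sin \<alpha>))"
    using sin_cos_squared_add[of \<beta>] sin_cos_squared_add[of \<alpha>] unfolding s_def by algebra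
  also have "\<dots> = D (\<beta> - \<alpha>) * D (\<beta> + \<alpha>)"
    by (simp add: D_def cos_add cos_diff)
  finally show ?thesis
    by (simp add: \<beta>_def \<theta>_Suc add.assoc)
qed

text \<open>Inversion divides a distance by the distances of both points to the centre of inversion;
  the original chord has length \<open>2 * sin \<alpha>\<close>.\<close>

lemma dist_consecutive:
  "(dist (harmonic_ngon N x0 t i) (harmonic_ngon N x0 t (Suc i)))\<^sup>2 * (D (\<theta> t i) * D (\<theta> t (Suc i))) =
    (2 * sin \<alpha>)\<^sup>2"
proof -
  define \<phi> \<psi> where "\<phi> = \<theta> t i" and "\<psi> = \<theta> t (Suc i)"
  have D0: "D \<phi> \<noteq> 0" "D \<psi> \<noteq> 0"
    using D_pos[of \<phi>] D_pos[of \<psi>] by auto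
  let ?x = "(cos \<phi> - x0) / D \<phi> - (cos \<psi> - x0) / D \<psi>" and ?y = "sin \<phi> / D \<phi> - sin \<psi> / D \<psi>"
  have "(dist (harmonic_ngon N x0 t i) (harmonic_ngon N x0 t (Suc i)))\<^sup>2 = ?x\<^sup>2 + ?y\<^sup>2"
    by (simp add: dist_norm harmonic_ngon_eq norm_Pair flip: \<phi>_def \<psi>_def)
  also have "?x = ((cos \<phi> - x0) * D \<psi> - (cos \<psi> - x0) * D \<phi>) / (D \<phi> * D \<psi>)"
    using D0 by (simp add: field_simps)
  also have "?y = (sin \<phi> * D \<psi> - sin \<psi> * D \<phi>) / (D \<phi> * D \<psi>)"
    using D0 by (simp add: field_simps)
  also have "(((cos \<phi> - x0) * D \<psi> - (cos \<psi> - x0) * D \<phi>) / (D \<phi> * D \<psi>))\<^sup>2 +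
      ((sin \<phi> * D \<psi> - sin \<psi> * D \<phi>) / (D \<phi> * D \<psi>))\<^sup>2 =
      (((cos \<phi> - x0) * D \<psi> - (cos \<psi> - x0) * D \<phi>)\<^sup>2 + (sin \<phi> * D \<psi> - sin \<psi> * D \<phi>)\<^sup>2) / (D \<phi> * D \<psi>)\<^sup>2"
    by (simp add: power_divide add_divide_distrib)
  also have "((cos \<phi> - x0) * D \<psi> - (cos \<psi> - x0) * D \<phi>)\<^sup>2 + (sin \<phi> * D \<psi> - sin \<psi> * D \<phi>)\<^sup>2 =
      (2 - 2 * (cos \<psi> * cos \<phi> + sin \<psi> * sin \<phi>)) * (D \<phi> * D \<psi>)"
    using sin_cos_squared_add[of \<phi>] sin_cos_squared_add[of \<psi>] unfolding D_def s_def by algebra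
  also have "2 - 2 * (cos \<psi> * cos \<phi> + sin \<psi> * sin \<phi>) = (2 * sin \<alpha>)\<^sup>2"
  proof -
    have "cos \<psi> * cos \<phi> + sin \<psi> * sin \<phi> = cos (2 * \<alpha>)"
      by (simp add: \<phi>_def \<psi>_def \<theta>_Suc flip: cos_diff)
    then show ?thesis
      by (simp add: cos_double_sin power_mult_distrib)
  qed
  finally show ?thesis
    using D0 by (simp add: power2_eq_square flip: \<phi>_def \<psi>_def)
qed

text \<open>The left side is the distance from \<open>centre\<close> to the sideline, so this is the
  proportionality that defines the symmedian point.\<close>

lemma inverse_norm_normal:
  "1 / norm (normal (\<theta> t i + \<alpha>)) =
    \<bar>m\<bar> * cos \<alpha> / (2 * sin \<alpha>) * dist (harmonic_ngon N x0 t i) (harmonic_ngon N x0 t (Suc i))"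
proof -
  let ?n = "norm (normal (\<theta> t i + \<alpha>))"
  let ?d = "dist (harmonic_ngon N x0 t i) (harmonic_ngon N x0 t (Suc i))"
  have "(\<bar>m\<bar> * cos \<alpha> * ?d * ?n)\<^sup>2 = ?d\<^sup>2 * (m * cos \<alpha> * ?n)\<^sup>2"
    by (simp add: power_mult_distrib)
  also have "\<dots> = (2 * sin \<alpha>)\<^sup>2"
    by (simp add: norm_normal dist_consecutive)
  finally have "\<bar>m\<bar> * cos \<alpha> * ?d * ?n = 2 * sin \<alpha>"
    using sin_\<alpha> cos_\<alpha> by (subst (asm) power2_eq_iff_nonneg) auto
  then show ?thesis
    using sin_\<alpha> normal_nonzero[of t i] by (simp add: field_simps)
qed

lemma harmonic_with_symmedian_point_centre:
  "harmonic_with_symmedian_point N (harmonic_ngon N x0 t) centre"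
  unfolding harmonic_with_symmedian_point_def
proof (intro conjI)
  show "\<exists>k. \<forall>i. infdist centre (sideline (harmonic_ngon N x0 t) i) =
      k * dist (harmonic_ngon N x0 t i) (harmonic_ngon N x0 t (Suc i))"
    by (intro exI[of _ "\<bar>m\<bar> * cos \<alpha> / (2 * sin \<alpha>)"] allI, subst inverse_norm_normal[symmetric])
      (simp add: sideline_eq infdist_line normal_nonzero)
qed (rule ngon_harmonic_ngon harmonic_ngon_cocircular centre_in_interior)+

text \<open>The polygon lies in the half-plane \<open>(x - centre) \<bullet> normal (\<theta> t i + \<alpha>) \<le> 1\<close> of each
  side, so the distances of an interior point to the sidelines are linear in the point; a second
  symmedian point would have constant inner product with all the normals, which lie on an ellipse.\<close>

lemma symmedian_point_unique:
  assumes "harmonic_with_symmedian_point N (harmonic_ngon N x0 t) K"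
  shows "K = centre"
proof -
  let ?P = "harmonic_ngon N x0 t" and ?n = "\<lambda>i. normal (\<theta> t i + \<alpha>)"
  from assms obtain k where K: "K \<in> interior (convex hull (?P ` {1..N}))"
    and k: "\<And>i. infdist K (sideline ?P i) = k * dist (?P i) (?P (Suc i))"
    unfolding harmonic_with_symmedian_point_def by blast
  let ?k = "\<bar>m\<bar> * cos \<alpha> / (2 * sin \<alpha>)"
  have "?k > 0"
    using m_nonzero sin_\<alpha> cos_\<alpha> by simp
  have inner_K: "(K - centre) \<bullet> ?n i = 1 - k / ?k" for i
  proof -
    have "convex hull (?P ` {1..N}) \<subseteq> {x. ?n i \<bullet> x \<le> 1 + centre \<bullet> ?n i}"
    proof (intro hull_minimal convex_halfspace_le image_subsetI CollectI)
      show "?n i \<bullet> ?P j \<le> 1 + centre \<bullet> ?n i" for j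
        using harmonic_ngon_halfplane[of t j i]
        by (simp add: inner_diff_left inner_commute[of "?n i" "?P j"])
    qed
    \<comment> \<open>This settles the sign inside the absolute value in the distance
      formula.\<close>
    then have "(K - centre) \<bullet> ?n i \<le> 1"
      using K interior_subset by (force simp: inner_diff_left inner_commute[of "?n i"])
    then have "k * dist (?P i) (?P (Suc i)) = (1 - (K - centre) \<bullet> ?n i) * (1 / norm (?n i))"
      using k[of i] by (simp add: sideline_eq infdist_line normal_nonzero)
    also have "\<dots> = (1 - (K - centre) \<bullet> ?n i) * ?k * dist (?P i) (?P (Suc i))"
      by (simp only: inverse_norm_normal mult.assoc)
    finally have "k = (1 - (K - centre) \<bullet> ?n i) * ?k"
      by (rule mult_right_cancel[THEN iffD1, rotated]) (simp add: harmonic_ngon_neq_Suc)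
    then have "k / ?k = 1 - (K - centre) \<bullet> ?n i"
      using \<open>?k > 0\<close> by (metis less_irrefl nonzero_mult_div_cancel_right)
    then show ?thesis
      by simp
  qed
  obtain v1 v2 where v: "K - centre = (v1, v2)"
    by (cases "K - centre")
  \<comment> \<open>Subtracting the conditions for consecutive sides removes the constant and the
    shift \<open>2 * x0\<close> of the normals, leaving a linear form in the cosine and sine of the
    shared vertex angle.\<close>
  have "v2 * cos (\<theta> t (Suc i)) + (- v1 / m) * sin (\<theta> t (Suc i)) = 0" for i
  proof -
    let ?\<phi> = "\<theta> t (Suc i)"
    have "\<theta> t i + \<alpha> = ?\<phi> - \<alpha>"
      by (simp add: \<theta>_Suc)
    then have "(v1, v2) \<bullet> normal (?\<phi> + \<alpha>) - (v1, v2) \<bullet> normal (?\<phi> - \<alpha>) = 0"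
      using inner_K[of i] inner_K[of "Suc i"] by (simp only: v)
    moreover have "(v1, v2) \<bullet> normal (?\<phi> + \<alpha>) - (v1, v2) \<bullet> normal (?\<phi> - \<alpha>) =
      2 * s * sin \<alpha> / cos \<alpha> * (v2 * cos ?\<phi> + (- v1 / m) * sin ?\<phi>)"
      using m_nonzero cos_\<alpha> by (simp add: normal_def cos_add cos_diff sin_add sin_diff field_simps)
    ultimately show ?thesis
      using s_pos sin_\<alpha> cos_\<alpha> by simp
  qed
  from this[of 0] this[of 1] have "v2 = 0" "- v1 / m = 0"
    using trig_form_eq_0[of v2 "\<theta> t (Suc 0)" "- v1 / m" "2 * \<alpha>"] sin_2\<alpha>
    by (simp_all only: \<theta>_Suc One_nat_def less_imp_neq[symmetric] not_False_eq_True)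
  then show ?thesis
    using v m_nonzero by (simp add: zero_prod_def[symmetric])
qed

lemma family_symmedian_point_eq: "family_symmedian_point N (harmonic_family N x0) = centre"
  unfolding family_symmedian_point_def harmonic_family_def
  using harmonic_with_symmedian_point_centre symmedian_point_unique by (intro the_equality) auto

section \<open>The polar polygons and their two ellipses\<close>

text \<open>The sideline equation has right side 1, so it is the equation of a polar. Two poles of
  the same sideline would differ by a vector orthogonal to two consecutive vertices.\<close>

lemma pole_sideline:
  "pole centre 1 (sideline (harmonic_ngon N x0 t) i) = centre + normal (\<theta> t i + \<alpha>)"
  unfolding pole_def
proof (rule the_equality)
  let ?P = "harmonic_ngon N x0 t" and ?n = "normal (\<theta> t i + \<alpha>)"
  show "polar centre 1 (centre + ?n) = sideline ?P i"
    by (simp add: polar_def sideline_eq inner_commute)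
  fix p assume p: "polar centre 1 p = sideline ?P i"
  have "(p - centre - ?n) \<bullet> (?P j - centre) = 0" if "j = i \<or> j = Suc i" for j
  proof -
    have on: "(?P j - centre) \<bullet> ?n = 1"
      using that harmonic_ngon_on_line by auto
    then have "?P j \<in> polar centre 1 p"
      by (simp add: p sideline_eq)
    with on show ?thesis
      unfolding inner_diff_left[of "p - centre" "?n"]
      by (simp add: polar_def inner_commute)
  qed
  then have "p - centre - ?n = 0"
    using orthogonal_consecutive_vertices[of _ t i] by blast
  then show "p = centre + ?n"
    by (simp add: algebra_simps)
qed

text \<open>Signed horizontal semiaxis, negative when \<open>x0\<^sup>2 > 1\<close>, so that one
  parametrization covers both cases.\<close>

definition a :: real where "a = s\<^sup>2 / (1 - x0\<^sup>2)"

definition xc :: real where "xc = x0 * (3 * x0 ^ 4 + 3 * x0\<^sup>2 + 2) / (x0 ^ 4 - 1)"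

lemma a_nonzero: "a \<noteq> 0"
  using s_pos x0_sq by (simp add: a_def)

lemma polar_image_eq:
  "polar_image centre 1 (harmonic_ngon N x0 t) i =
    (xc + a / cos \<alpha> * cos (\<theta> t i + \<alpha>), s / cos \<alpha> * sin (\<theta> t i + \<alpha>))"
proof -
  have e: "x0 ^ 4 - 1 = - (s * (1 - x0\<^sup>2))"
    by (simp add: s_def power4_eq_xxxx power2_eq_square algebra_simps)
  have nz: "1 - x0\<^sup>2 \<noteq> 0" "s \<noteq> 0"
    using x0_sq s_pos by auto
  \<comment> \<open>The fraction splits into the abscissa \<open>x0 ^ 3 / s\<close> of
    \<open>centre\<close> and the constant part \<open>- 2 * x0 / m\<close> of the first coordinate
    of \<open>normal\<close>.\<close>
  have "xc = - (x0 * (3 * x0 ^ 4 + 3 * x0\<^sup>2 + 2)) / (s * (1 - x0\<^sup>2))"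
    using nz unfolding xc_def e by simp
  also have "- (x0 * (3 * x0 ^ 4 + 3 * x0\<^sup>2 + 2)) = x0 ^ 3 * (1 - x0\<^sup>2) - 2 * x0 * s\<^sup>2"
    unfolding s_def by algebra
  also have "\<dots> / (s * (1 - x0\<^sup>2)) = x0 ^ 3 / s - 2 * x0 / m"
    using nz by (simp add: m_def diff_divide_distrib[of "_ ^ 3 * _"] power2_eq_square)
  finally have "xc = x0 ^ 3 / s - 2 * x0 / m" .
  moreover have "s * c / cos \<alpha> / m = a / cos \<alpha> * c" for c
    using nz cos_\<alpha> by (simp add: m_def a_def power2_eq_square mult_ac)
  ultimately show ?thesis
    by (simp add: polar_image_def pole_sideline)
      (simp add: normal_def centre_def diff_divide_distrib)
qed

text \<open>The angle of vertex \<open>Suc i\<close> is midway between the mid-angles of the two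
  sides meeting there. So each side of the polar polygon has as midpoint the point
  \<open>p t i\<close> of the inner ellipse, and runs along the velocity
  \<open>v t i\<close>.\<close>

lemma polar_image_midpoint:
  defines "p \<equiv> \<lambda>t i. (xc + a * cos (\<theta> t (Suc i)), s * sin (\<theta> t (Suc i)))"
    and "v \<equiv> \<lambda>t i. (- a * sin (\<theta> t (Suc i)), s * cos (\<theta> t (Suc i)))"
  shows "polar_image centre 1 (harmonic_ngon N x0 t) i = p t i - tan \<alpha> *\<^sub>R v t i"
    and "polar_image centre 1 (harmonic_ngon N x0 t) (Suc i) = p t i + tan \<alpha> *\<^sub>R v t i"
proof -
  have prev: "\<theta> t i + \<alpha> = \<theta> t (Suc i) - \<alpha>"
    by (simp add: \<theta>_Suc)
  show "polar_image centre 1 (harmonic_ngon N x0 t) i = p t i - tan \<alpha> *\<^sub>R v t i"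
    unfolding polar_image_eq prev p_def v_def using cos_\<alpha>
    by (simp add: cos_diff sin_diff tan_def field_simps)
  show "polar_image centre 1 (harmonic_ngon N x0 t) (Suc i) = p t i + tan \<alpha> *\<^sub>R v t i"
    unfolding polar_image_eq p_def v_def using cos_\<alpha>
    by (simp add: cos_add sin_add tan_def field_simps)
qed

lemma ngon_polar_image: "ngon N (polar_image centre 1 (harmonic_ngon N x0 t))"
  unfolding ngon_def
proof (intro conjI allI inj_onI)
  show "polar_image centre 1 (harmonic_ngon N x0 t) (i + N) =
      polar_image centre 1 (harmonic_ngon N x0 t) i" for i
  proof -
    have "\<theta> t (i + N) + \<alpha> = \<theta> t i + \<alpha> + 2 * pi"
      by (simp add: \<theta>_period)
    then show ?thesis
      by (simp only: polar_image_eq cos_periodic sin_periodic)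
  qed
  fix i j assume ij: "i \<in> {1..N}" "j \<in> {1..N}"
    and "polar_image centre 1 (harmonic_ngon N x0 t) i = polar_image centre 1 (harmonic_ngon N x0 t) j"
  \<comment> \<open>Adding \<alpha> only rotates the underlying regular polygon, so injectivity of
    its vertices carries over.\<close>
  moreover have "\<theta> t k + \<alpha> = \<theta> (t + \<alpha>) k" for k
    by (simp add: \<theta>_def)
  ultimately show "i = j"
    using a_nonzero s_pos cos_\<alpha> by (intro \<theta>_inj[OF ij, of "t + \<alpha>"]) (auto simp: polar_image_eq)
qed

lemma interscribed_polar_image:
  "interscribed (polar_image centre 1 (harmonic_ngon N x0 t))
    (ellipse xc (a / cos \<alpha>) (s / cos \<alpha>)) (ellipse xc a s)"
  unfolding interscribed_def
proof (intro conjI allI)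
  let ?Q = "polar_image centre 1 (harmonic_ngon N x0 t)"
  fix i
  show "?Q i \<in> ellipse xc (a / cos \<alpha>) (s / cos \<alpha>)"
    using a_nonzero s_pos cos_\<alpha> by (subst ellipse_iff_param) (auto simp: polar_image_eq)
  let ?p = "(xc + a * cos (\<theta> t (Suc i)), s * sin (\<theta> t (Suc i)))"
  let ?v = "(- a * sin (\<theta> t (Suc i)), s * cos (\<theta> t (Suc i)))"
  have "?p = midpoint (?Q i) (?Q (Suc i))"
    unfolding polar_image_midpoint[of t i] midpoint_def by (simp flip: scaleR_2)
  then have "?p \<in> side ?Q i"
    unfolding side_def by (simp only: midpoint_in_closed_segment)
  moreover have "sideline ?Q i = range (\<lambda>r. ?p + r *\<^sub>R ?v)"
    unfolding sideline_def polar_image_midpoint[of t i]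
    using sin_\<alpha> cos_\<alpha> by (intro affine_hull_symmetric_pair) (simp add: tan_def)
  then have "tangent_line_at (ellipse xc a s) ?p (sideline ?Q i)"
    using tangent_line_ellipse[of a s xc "\<theta> t (Suc i)"] a_nonzero s_pos by simp
  ultimately show "\<exists>p\<in>side ?Q i. tangent_line_at (ellipse xc a s) p (sideline ?Q i)"
    by blast
qed

lemma outer_ellipse_covered:
  assumes "p \<in> ellipse xc (a / cos \<alpha>) (s / cos \<alpha>)"
  shows "\<exists>t. polar_image centre 1 (harmonic_ngon N x0 t) 0 = p"
proof -
  from assms obtain \<phi> where "p = (xc + a / cos \<alpha> * cos \<phi>, s / cos \<alpha> * sin \<phi>)"
    using a_nonzero s_pos cos_\<alpha> by (subst (asm) ellipse_iff_param) auto
  \<comment> \<open>Polar vertex 0 sits at angle \<open>t + \<alpha>\<close>, whence the parameter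
    \<open>\<phi> - \<alpha>\<close>.\<close>
  then have "polar_image centre 1 (harmonic_ngon N x0 (\<phi> - \<alpha>)) 0 = p"
    by (simp add: polar_image_eq \<theta>_def)
  then show ?thesis ..
qed

lemma poncelet_family_polar_image:
  "poncelet_family N (polar_image centre 1 ` harmonic_family N x0)
    (ellipse xc (a / cos \<alpha>) (s / cos \<alpha>)) (ellipse xc a s)"
  unfolding poncelet_family_def harmonic_family_def
  using ngon_polar_image interscribed_polar_image outer_ellipse_covered by fastforce

end

theorem proposition4:
  fixes N :: nat and \<alpha> x0 a\<^sub>h b\<^sub>h x\<^sub>h a\<^sub>H b\<^sub>H x\<^sub>H :: real and K :: point
  assumes "N \<ge> 3" and "\<alpha> = pi / real N"
    and "x0 \<noteq> 1" and "x0 \<noteq> -1"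
    and "K = family_symmedian_point N (harmonic_family N x0)"
    and "a\<^sub>h = (x0^2 + 1)^2 / \<bar>1 - x0^2\<bar>"
    and "b\<^sub>h = x0^2 + 1"
    and "x\<^sub>h = x0 * (3 * x0^4 + 3 * x0^2 + 2) / (x0^4 - 1)"
    and "a\<^sub>H = a\<^sub>h / cos \<alpha>"
    and "b\<^sub>H = b\<^sub>h / cos \<alpha>"
    and "x\<^sub>H = x\<^sub>h"
  shows "a\<^sub>h > 0 \<and> b\<^sub>h > 0 \<and> a\<^sub>H > 0 \<and> b\<^sub>H > 0 \<and>
    homothetic (ellipse x\<^sub>h a\<^sub>h b\<^sub>h) (ellipse x\<^sub>H a\<^sub>H b\<^sub>H) \<and>
    concentric (ellipse x\<^sub>h a\<^sub>h b\<^sub>h) (ellipse x\<^sub>H a\<^sub>H b\<^sub>H) \<and>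
    poncelet_family N (polar_image K 1 ` harmonic_family N x0)
      (ellipse x\<^sub>H a\<^sub>H b\<^sub>H) (ellipse x\<^sub>h a\<^sub>h b\<^sub>h)"
proof -
  have x0: "x0\<^sup>2 \<noteq> 1"
    using assms(3,4) by (simp add: power2_eq_1_iff)
  interpret P: inverted_regular_ngons N x0
    using assms(1) x0 by unfold_locales
  have \<alpha>: "\<alpha> = P.\<alpha>" and x: "x\<^sub>h = P.xc" "x\<^sub>H = P.xc" and b: "b\<^sub>h = P.s" "b\<^sub>H = P.s / cos P.\<alpha>"
    and K: "K = P.centre"
    using assms by (auto simp: P.\<alpha>_def P.xc_def P.s_def P.family_symmedian_point_eq)
  have a: "a\<^sub>h = \<bar>P.a\<bar>" "a\<^sub>H = \<bar>P.a\<bar> / cos P.\<alpha>"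
    using assms(6,9) \<alpha> by (simp_all add: P.a_def P.s_def add.commute)
  \<comment> \<open>Only squares of the semiaxes enter an ellipse, which reconciles the signed
    \<open>P.a\<close> with the absolute value in the statement.\<close>
  have abs: "ellipse c \<bar>r\<bar> b = ellipse c r b" "ellipse c (\<bar>r\<bar> / k) b = ellipse c (r / k) b" for c r b k
    by (auto simp: ellipse_def power_divide)
  have "homothetic (ellipse P.xc P.a P.s) (ellipse P.xc (P.a / cos P.\<alpha>) (P.s / cos P.\<alpha>))"
    using homothetic_ellipse[of "1 / cos P.\<alpha>" P.xc P.a P.s] P.cos_\<alpha> by simp
  moreover have "concentric (ellipse P.xc P.a P.s) (ellipse P.xc (P.a / cos P.\<alpha>) (P.s / cos P.\<alpha>))"
    unfolding concentric_def using symmetry_center_ellipse by blast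
  ultimately show ?thesis
    using P.poncelet_family_polar_image P.a_nonzero P.s_pos P.cos_\<alpha>
    unfolding a b x K abs by simp
qed

end
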